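(* Let $n\ge2$, let $S=(s_1,\ldots,s_n)\in\mathcal{G}_n$, and write $B:=A(S)+1$. Then $$S_{\pm}=\{s_n-B+2t : t\in\Sigma(W_S)\}.$$ Consequently, $$S_{\pm}=C_S\iff \Sigma(W_S)=\{0,1,\ldots,B\}.$$
   Context: For a finite integer sequence $S=(s_1,\ldots,s_n)$, its difference triangle is defined by $s_a^0:=s_a$ and $s_a^b:=|s_{a+1}^{b-1}-s_a^{b-1}|$ for $b\ge 1$, $1\le a\le n-b$ (superscripts are row indices, not powers). $S$ is Gilbreath if $s_1^b=1$ for every $1\le b\le n-1$. For $n\ge 2$, $\mathcal{G}_n$ is the set of strictly increasing Gilbreath integer sequences $(s_1,\ldots,s_n)$ of length $n$ with $(s_1,s_2)=(2,3)$. The right anti-diagonal of $S$ is $(e_1,\ldots,e_{n-1})$ with $e_i:=s_{n-i}^i$, and $A(S):=\sum_{i=1}^{n-1}e_i$. The candidate set is $C_S:=\{k\in\mathbb{Z}:|k-s_n|\le A(S)+1,\ k\equiv s_n\pmod 2\}$. The signed-sum set is $S_{\pm}:=\{s_n+\epsilon_1e_1+\cdots+\epsilon_{n-1}e_{n-1}+\epsilon_n:\epsilon_1,\ldots,\epsilon_n\in\{\pm1\}\}$. The weight multiset is $W_S:=\{e_1,e_2,\ldots,e_{n-1},1\}$ (with multiplicities). For a finite multiset $W=\{w_1,\ldots,w_m\}$ of nonnegative integers, $\Sigma(W):=\{\sum_{i\in I}w_i: I\subseteq\{1,\ldots,m\}\}$ is its set of subset sums. *)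

theory Defs
  imports
    Main
    "HOL-Library.Multiset"
    "HOL-Combinatorics.List_Permutation"
    "HOL-Number_Theory.Cong"
begin

(* A sequence (s_1, ..., s_n) is a list of length n.  The row b and the position a are the
   indices of s_a^b, with positions counted from 1; only 1 <= a <= n - b is meaningful. *)
fun diff_triangle :: "int list \<Rightarrow> nat \<Rightarrow> nat \<Rightarrow> int" where
  "diff_triangle S 0 a = S ! (a - 1)"
| "diff_triangle S (Suc b) a = \<bar>diff_triangle S b (a + 1) - diff_triangle S b a\<bar>"

definition gilbreath :: "int list \<Rightarrow> bool" where
  "gilbreath S \<longleftrightarrow> (\<forall>b \<in> {1..length S - 1}. diff_triangle S b 1 = 1)"

(* Meant for n >= 2. *)
definition gilbreath_seqs :: "nat \<Rightarrow> int list set" where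
  "gilbreath_seqs n =
    {S. length S = n \<and> sorted_wrt (<) S \<and> gilbreath S \<and> S ! 0 = 2 \<and> S ! 1 = 3}"

definition anti_diag :: "int list \<Rightarrow> nat \<Rightarrow> int" where
  "anti_diag S i = diff_triangle S i (length S - i)"

definition anti_diag_sum :: "int list \<Rightarrow> int" where
  "anti_diag_sum S = (\<Sum>i = 1..length S - 1. anti_diag S i)"

definition candidate_set :: "int list \<Rightarrow> int set" where
  "candidate_set S = {k. \<bar>k - last S\<bar> \<le> anti_diag_sum S + 1 \<and> [k = last S] (mod 2)}"

definition signed_sums :: "int list \<Rightarrow> int set" where
  "signed_sums S =
    {last S + (\<Sum>i = 1..length S - 1. \<epsilon> i * anti_diag S i) + \<epsilon> (length S) | \<epsilon> :: nat \<Rightarrow> int.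
      \<forall>i \<in> {1..length S}. \<epsilon> i \<in> {1, -1}}"

definition weights :: "int list \<Rightarrow> int multiset" where
  "weights S = add_mset 1 (image_mset (anti_diag S) (mset_set {1..length S - 1}))"

(* The list w ranges over the enumerations of W; by subset_sums_mset below, the choice of
   enumeration is immaterial. *)
definition subset_sums :: "int multiset \<Rightarrow> int set" where
  "subset_sums W = {\<Sum>i\<in>I. w ! i | w I. mset w = W \<and> I \<subseteq> {..<length w}}"

lemma subset_sums_mset:
  "subset_sums (mset w) = {\<Sum>i\<in>I. w ! i | I. I \<subseteq> {..<length w}}" (is "?L = ?R")
proof
  show "?L \<subseteq> ?R"
  proof
    fix t assume "t \<in> ?L"
    then obtain v I where v: "mset v = mset w" and I: "I \<subseteq> {..<length v}"
      and t: "t = (\<Sum>i\<in>I. v ! i)"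
      unfolding subset_sums_def by blast
    obtain p where p: "p permutes {..<length w}" and pv: "permute_list p w = v"
      using v mset_eq_permutation by metis
    have len: "length v = length w"
      using v by (metis size_mset)
    have "t = (\<Sum>i\<in>I. w ! p i)"
      unfolding t using I len p pv by (intro sum.cong) (auto simp: permute_list_nth)
    also have "\<dots> = (\<Sum>i\<in>p ` I. w ! i)"
      using p by (simp add: sum.reindex permutes_inj_on)
    finally have "t = (\<Sum>i\<in>p ` I. w ! i)" .
    moreover have "p ` I \<subseteq> {..<length w}"
      using I len permutes_image[OF p] by auto
    ultimately show "t \<in> ?R" by blast
  qed
qed (auto simp: subset_sums_def)

end

theory Submission
  imports Defs
begin

text \<open>
  Writing each sign as \<open>2 * x - 1\<close> with \<open>x\<close> in \<open>{0, 1}\<close> turns a signed sum into \<open>-B\<close> plus twice a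
  subset sum. For the equivalence, the candidate set must be the image of \<open>{0..B}\<close> under the same
  injective map \<open>t \<mapsto> s\<^sub>n - B + 2 * t\<close>, which holds because \<open>B\<close> is even. Indeed, the leading
  entries of the rows \<open>b \<ge> 1\<close> are \<open>1\<close>, so the second entries are even, and hence so are all later
  entries; thus \<open>e\<^bsub>n-1\<^esub> = 1\<close> is the only odd entry of the anti-diagonal.
\<close>

text \<open>A distinct enumeration of \<open>A\<close> matches list positions with elements of
  \<open>A\<close>, so subsets of positions become subsets of \<open>A\<close>, and equal values of
  \<open>f\<close> keep their multiplicity.\<close>

lemma subset_sums_image_mset:
  fixes f :: "'a \<Rightarrow> int"
  assumes "finite A"
  shows "subset_sums (image_mset f (mset_set A)) = {sum f J | J. J \<subseteq> A}"
proof -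
  obtain xs where xs: "set xs = A" "distinct xs"
    using finite_distinct_list[OF assms] by blast
  have sum_nth: "(\<Sum>i\<in>I. map f xs ! i) = sum f ((!) xs ` I)" if "I \<subseteq> {..<length xs}" for I
  proof -
    have "inj_on ((!) xs) I"
      using that xs(2) by (auto intro: inj_on_nth)
    then have "sum f ((!) xs ` I) = (\<Sum>i\<in>I. f (xs ! i))"
      by (simp add: sum.reindex)
    also have "\<dots> = (\<Sum>i\<in>I. map f xs ! i)"
      using that by (intro sum.cong) auto
    finally show ?thesis by simp
  qed
  have nth_image: "(!) xs ` {..<length xs} = A"
    using xs(1) by (auto simp: set_conv_nth)
  have "image_mset f (mset_set A) = mset (map f xs)"
    using xs mset_set_set by force
  then have "subset_sums (image_mset f (mset_set A))
      = {\<Sum>i\<in>I. map f xs ! i | I. I \<subseteq> {..<length xs}}"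
    using subset_sums_mset[of "map f xs"] by simp
  \<comment> \<open>Factoring through the image map on \<open>Pow\<close> lets
    \<open>image_Pow_surj\<close> turn sets of positions into all subsets of
    \<open>A\<close>.\<close>
  also have "\<dots> = sum f ` (`) ((!) xs) ` Pow {..<length xs}"
  proof -
    have "{\<Sum>i\<in>I. map f xs ! i | I. I \<subseteq> {..<length xs}}
        = (\<lambda>I. \<Sum>i\<in>I. map f xs ! i) ` Pow {..<length xs}"
      by blast
    also have "\<dots> = (\<lambda>I. sum f ((!) xs ` I)) ` Pow {..<length xs}"
      using sum_nth by (intro image_cong) auto
    finally show ?thesis
      by (simp only: image_image)
  qed
  also have "\<dots> = {sum f J | J. J \<subseteq> A}"
    unfolding image_Pow_surj[OF nth_image] by auto
  finally show ?thesis .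
qed

text \<open>Sign choices on \<open>A\<close> correspond to subsets \<open>J\<close>: the indices
  that carry the sign \<open>1\<close>.\<close>

lemma signed_sums_eq_subset_sums:
  fixes f :: "'a \<Rightarrow> int"
  assumes "finite A"
  shows "{\<Sum>i\<in>A. \<epsilon> i * f i | \<epsilon>. \<forall>i\<in>A. \<epsilon> i \<in> {1, -1}}
    = {2 * sum f J - sum f A | J. J \<subseteq> A}"
proof -
  have sum_signs: "(\<Sum>i\<in>A. (if i \<in> J then 1 else -1) * f i) = 2 * sum f J - sum f A"
    if "J \<subseteq> A" for J
  proof -
    have "(\<Sum>i\<in>A. (if i \<in> J then 1 else -1) * f i) = (\<Sum>i\<in>A. 2 * (if i \<in> J then f i else 0) - f i)"
      by (intro sum.cong) auto
    also have "\<dots> = 2 * (\<Sum>i\<in>A. if i \<in> J then f i else 0) - sum f A"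
      by (simp add: sum_subtractf sum_distrib_left)
    also have "(\<Sum>i\<in>A. if i \<in> J then f i else 0) = sum f J"
      using assms that by (simp add: sum.inter_restrict[symmetric] Int_absorb1)
    finally show ?thesis .
  qed
  show ?thesis
  proof (intro set_eqI iffI; clarify)
    fix \<epsilon> :: "'a \<Rightarrow> int" assume \<epsilon>: "\<forall>i\<in>A. \<epsilon> i \<in> {1, -1}"
    have "(\<Sum>i\<in>A. \<epsilon> i * f i) = (\<Sum>i\<in>A. (if i \<in> {i \<in> A. \<epsilon> i = 1} then 1 else -1) * f i)"
      using \<epsilon> by (intro sum.cong) auto
    also have "\<dots> = 2 * sum f {i \<in> A. \<epsilon> i = 1} - sum f A"
      by (rule sum_signs) auto
    finally show "\<exists>J. (\<Sum>i\<in>A. \<epsilon> i * f i) = 2 * sum f J - sum f A \<and> J \<subseteq> A"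
      by blast
  next
    fix J assume "J \<subseteq> A"
    then show "\<exists>\<epsilon>. 2 * sum f J - sum f A = (\<Sum>i\<in>A. \<epsilon> i * f i) \<and> (\<forall>i\<in>A. \<epsilon> i \<in> {1, -1})"
      by (intro exI[of _ "\<lambda>i. if i \<in> J then 1 else -1"]) (simp add: sum_signs)
  qed
qed

text \<open>Evenness spreads to the right, for all rows at once: an entry differs from its left
  neighbour by, up to sign, the entry below that neighbour, and both of these are even by
  induction.\<close>

lemma even_diff_triangle:
  assumes "gilbreath S" "a \<ge> 2" "b \<ge> 1" "a + b \<le> length S"
  shows "even (diff_triangle S b a)"
  using assms(2-4)
proof (induction a arbitrary: b rule: dec_induct)
  case base
  \<comment> \<open>The second entry of row \<open>b\<close> is at distance 1 from 1, hence 0 or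
    2.\<close>
  then have "diff_triangle S b 1 = 1" "diff_triangle S (Suc b) 1 = 1"
    using assms(1) by (auto simp: gilbreath_def simp del: diff_triangle.simps)
  then show ?case
    by (auto simp: numeral_2_eq_2 abs_if split: if_splits)
next
  case (step a)
  then have "even (diff_triangle S b a)" "even (diff_triangle S (Suc b) a)"
    by (auto intro!: step.IH simp del: diff_triangle.simps)
  then show ?case
    by auto
qed

lemma odd_anti_diag_sum:
  assumes "gilbreath S" "length S \<ge> 2"
  shows "odd (anti_diag_sum S)"
proof -
  obtain m where m: "length S = Suc (Suc m)"
    using assms(2) by (metis add_2_eq_Suc le_Suc_ex)
  have "anti_diag_sum S = (\<Sum>i = 1..m. anti_diag S i) + anti_diag S (Suc m)"
    by (simp add: anti_diag_sum_def m)
  \<comment> \<open>For \<open>i \<le> m\<close> the entry sits at position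
    \<open>length S - i \<ge> 2\<close>; only \<open>i = Suc m\<close> reaches the first
    column.\<close>
  moreover have "even (\<Sum>i = 1..m. anti_diag S i)"
    using assms(1) m by (intro dvd_sum) (auto simp: anti_diag_def intro!: even_diff_triangle)
  moreover have "anti_diag S (Suc m) = 1"
    using assms(1) m by (simp add: anti_diag_def gilbreath_def del: diff_triangle.simps)
  ultimately show ?thesis by simp
qed

lemma signed_sums_eq_image:
  assumes "S \<noteq> []"
  shows "signed_sums S = (\<lambda>t. last S - (anti_diag_sum S + 1) + 2 * t) ` subset_sums (weights S)"
proof -
  define m where "m = length S - 1"
  have len: "length S = Suc m"
    using assms by (cases S) (auto simp: m_def)
  \<comment> \<open>The extra weight 1 becomes the value at the index \<open>length S\<close>, so
    that all weights and signs share one index set.\<close>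
  define f where "f i = (if i = Suc m then 1 else anti_diag S i)" for i
  have sum_f: "sum f {1..Suc m} = anti_diag_sum S + 1"
    by (simp add: anti_diag_sum_def f_def len)
  have "image_mset f (mset_set {1..m}) = image_mset (anti_diag S) (mset_set {1..m})"
    by (intro image_mset_cong) (auto simp: f_def)
  then have "weights S = image_mset f (mset_set {1..Suc m})"
    by (simp add: weights_def len atLeastAtMostSuc_conv f_def)
  then have subs: "subset_sums (weights S) = {sum f J | J. J \<subseteq> {1..Suc m}}"
    by (simp add: subset_sums_image_mset)
  have "last S + (\<Sum>i = 1..m. \<epsilon> i * anti_diag S i) + \<epsilon> (Suc m)
      = last S + (\<Sum>i = 1..Suc m. \<epsilon> i * f i)" for \<epsilon>
    by (simp add: f_def)
  then have "signed_sums S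
      = (+) (last S) ` {\<Sum>i = 1..Suc m. \<epsilon> i * f i | \<epsilon>. \<forall>i\<in>{1..Suc m}. \<epsilon> i \<in> {1, -1}}"
    unfolding signed_sums_def len diff_Suc_1 image_Collect by (simp only:) blast
  also have "\<dots> = (\<lambda>t. last S - sum f {1..Suc m} + 2 * t) ` {sum f J | J. J \<subseteq> {1..Suc m}}"
    unfolding signed_sums_eq_subset_sums[OF finite_atLeastAtMost]
    by (force simp: image_iff)
  finally show ?thesis
    by (simp only: sum_f subs)
qed

text \<open>Since \<open>anti_diag_sum S + 1\<close> is even, shifting by it preserves the parity
  class of \<open>last S\<close>, and the bound on the distance becomes the range of
  \<open>t\<close>.\<close>

lemma candidate_set_eq_image:
  assumes "odd (anti_diag_sum S)"
  shows "candidate_set S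
    = (\<lambda>t. last S - (anti_diag_sum S + 1) + 2 * t) ` {0..anti_diag_sum S + 1}"
proof (intro set_eqI iffI)
  fix k assume "k \<in> candidate_set S"
  then have k: "\<bar>k - last S\<bar> \<le> anti_diag_sum S + 1" "even (k - last S)"
    by (auto simp: candidate_set_def cong_iff_dvd_diff)
  then have "even (k - last S + (anti_diag_sum S + 1))"
    using assms by simp
  then obtain t where "k - last S + (anti_diag_sum S + 1) = 2 * t"
    by (elim evenE)
  with k(1) show "k \<in> (\<lambda>t. last S - (anti_diag_sum S + 1) + 2 * t) ` {0..anti_diag_sum S + 1}"
    by (intro image_eqI[of _ _ t]) auto
qed (use assms in \<open>auto simp: candidate_set_def cong_iff_dvd_diff\<close>)

theorem theorem12:
  fixes n :: nat and S :: "int list" and B :: int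
  assumes "n \<ge> 2"
    and "S \<in> gilbreath_seqs n"
    and "B = anti_diag_sum S + 1"
  shows "signed_sums S = {last S - B + 2 * t | t. t \<in> subset_sums (weights S)}
    \<and> (signed_sums S = candidate_set S \<longleftrightarrow> subset_sums (weights S) = {0..B})"
proof -
  have S: "gilbreath S" "length S \<ge> 2"
    using assms(1,2) by (auto simp: gilbreath_seqs_def)
  let ?g = "\<lambda>t. last S - B + 2 * t"
  have signed: "signed_sums S = ?g ` subset_sums (weights S)"
    using S(2) unfolding assms(3) by (intro signed_sums_eq_image) auto
  have candidates: "candidate_set S = ?g ` {0..B}"
    unfolding assms(3) by (intro candidate_set_eq_image odd_anti_diag_sum S)
  have "inj ?g"
    by (auto simp: inj_def)
  then show ?thesis
    unfolding signed candidates by (auto simp: inj_image_eq_iff)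
qed

end
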